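(* Let $c\in\mathbb{C}$, $r>0$, and let $k=k_1k_2$ with $k_1,k_2$ positive integers. Let $M(z)=\frac{1-z}{z}$. Then, as rational functions of $z$, $$R_{c,r,k}(z)=R_{0,1,k_2}\big(M(R_{c,r,k_1}(z))\big).$$ Let $\sigma_1^{(k_2)},\dots,\sigma_{k_2}^{(k_2)}$ be the $k_2$ roots of $x^{k_2}=-1$, and for each $i$ with $\sigma_i^{(k_2)}\ne-1$ put $$c_i^{(k_2)}=-\frac{1}{k_2}\,\frac{\sigma_i^{(k_2)}}{1+\sigma_i^{(k_2)}},\qquad s_i^{(k_2)}=\frac{1}{1+\sigma_i^{(k_2)}}.$$ If $k_2$ is even, then $$R_{c,r,k}(z)=\sum_{i=1}^{k_2}c_i^{(k_2)}\big(s_i^{(k_2)}-R_{c,r,k_1}(z)\big)^{-1}R_{c,r,k_1}(z).$$ If $k_2$ is odd, and the roots are ordered so that $\sigma_{k_2}^{(k_2)}=-1$, then $$R_{c,r,k}(z)=\sum_{i=1}^{k_2-1}c_i^{(k_2)}\big(s_i^{(k_2)}-R_{c,r,k_1}(z)\big)^{-1}R_{c,r,k_1}(z)+\frac{1}{k_2}R_{c,r,k_1}(z).$$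
   Context: For $c\in\mathbb{C}$, $r>0$ and a positive integer $k$, $R_{c,r,k}$ is the rational function obtained from the $k$-point trapezoidal quadrature of $\frac{1}{2\pi\imath}\oint_{|\zeta-c|=r}\frac{1}{\zeta-z}\,\mathrm{d}\zeta$: $R_{c,r,k}(z)=\sum_{i=1}^k\frac{w_i^{(k)}}{p_i^{(k)}-z}$ with $p_i^{(k)}=re^{\imath\theta_i^{(k)}}+c$, $w_i^{(k)}=re^{\imath\theta_i^{(k)}}/k$, $\theta_i^{(k)}=(2i-1)\pi/k$, $i=1,\dots,k$. In particular $R_{0,1,k}(z)=\frac1k\sum_{i=1}^k\frac{\sigma_i^{(k)}}{\sigma_i^{(k)}-z}$, where $\sigma_1^{(k)},\dots,\sigma_k^{(k)}$ are the roots of $x^k=-1$. *)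

theory Defs
  imports
    "HOL-Analysis.Analysis"
    "HOL-Computational_Algebra.Polynomial_Factorial"
    "HOL-Computational_Algebra.Field_as_Ring"
begin

text \<open>Rational functions over the complex numbers are the elements of the field of fractions of
  the polynomial ring, so that an equation between them is an identity of rational functions,
  not of partial functions on the complex plane.\<close>

type_synonym ratfun = "complex poly fract"

definition rf_const :: "complex \<Rightarrow> ratfun" where
  "rf_const a = to_fract [:a:]"

definition rf_Z :: ratfun where
  "rf_Z = to_fract [:0, 1:]"

definition rf_eval_poly :: "complex poly \<Rightarrow> ratfun \<Rightarrow> ratfun" where
  "rf_eval_poly p g = poly (map_poly rf_const p) g"

text \<open>The composite \<open>f \<circ> g\<close>, by substituting \<open>g\<close> into the reduced fraction for \<open>f\<close>.
  It is undefined (and then \<open>0\<close> by convention) only if \<open>g\<close> is a constant that is a pole of \<open>f\<close>.\<close>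

definition rf_comp :: "ratfun \<Rightarrow> ratfun \<Rightarrow> ratfun" where
  "rf_comp f g = rf_eval_poly (fst (quot_of_fract f)) g / rf_eval_poly (snd (quot_of_fract f)) g"

definition trap_angle :: "nat \<Rightarrow> nat \<Rightarrow> real" where
  "trap_angle k i = (2 * real i - 1) * pi / real k"

definition trap_node :: "complex \<Rightarrow> real \<Rightarrow> nat \<Rightarrow> nat \<Rightarrow> complex" where
  "trap_node c r k i = complex_of_real r * exp (\<i> * complex_of_real (trap_angle k i)) + c"

definition trap_weight :: "real \<Rightarrow> nat \<Rightarrow> nat \<Rightarrow> complex" where
  "trap_weight r k i = complex_of_real r * exp (\<i> * complex_of_real (trap_angle k i)) / of_nat k"

definition trap_R :: "complex \<Rightarrow> real \<Rightarrow> nat \<Rightarrow> ratfun" where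
  "trap_R c r k =
     (\<Sum>i = 1..k. rf_const (trap_weight r k i) / (rf_const (trap_node c r k i) - rf_Z))"

definition rf_M :: ratfun where
  "rf_M = (1 - rf_Z) / rf_Z"

definition coef_c :: "nat \<Rightarrow> complex \<Rightarrow> complex" where
  "coef_c m \<sigma> = - (1 / of_nat m) * (\<sigma> / (1 + \<sigma>))"

definition shift_s :: "complex \<Rightarrow> complex" where
  "shift_s \<sigma> = 1 / (1 + \<sigma>)"

lemma rf_const_0 [simp]: "rf_const 0 = 0"
  and rf_const_add: "rf_const (a + b) = rf_const a + rf_const b"
  and rf_const_mult: "rf_const (a * b) = rf_const a * rf_const b"
  by (simp_all add: rf_const_def flip: to_fract_add to_fract_mult)

lemma rf_eval_poly_pCons: "rf_eval_poly (pCons a p) g = rf_const a + g * rf_eval_poly p g"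
  by (simp add: rf_eval_poly_def map_poly_pCons)

lemma rf_eval_poly_0 [simp]: "rf_eval_poly 0 g = 0"
  by (simp add: rf_eval_poly_def)

lemma rf_eval_poly_add: "rf_eval_poly (p + q) g = rf_eval_poly p g + rf_eval_poly q g"
  by (induction p q rule: poly_induct2) (simp_all add: rf_eval_poly_pCons rf_const_add algebra_simps)

lemma rf_eval_poly_smult: "rf_eval_poly (smult a p) g = rf_const a * rf_eval_poly p g"
  by (induction p) (simp_all add: rf_eval_poly_pCons rf_const_mult algebra_simps)

lemma rf_eval_poly_mult: "rf_eval_poly (p * q) g = rf_eval_poly p g * rf_eval_poly q g"
  by (induction p)
     (simp_all add: rf_eval_poly_pCons rf_eval_poly_add rf_eval_poly_smult algebra_simps)

text \<open>Any fraction representing \<open>f\<close> may be used for substitution as long as its denominator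
  does not vanish.\<close>

lemma rf_comp_Fract:
  assumes "rf_eval_poly q g \<noteq> 0"
  shows "rf_comp (Fract p q) g = rf_eval_poly p g / rf_eval_poly q g"
proof -
  define a where "a = fst (quot_of_fract (Fract p q))"
  define b where "b = snd (quot_of_fract (Fract p q))"
  have q: "q \<noteq> 0" using assms by auto
  have b: "b \<noteq> 0" by (simp add: b_def)
  have "Fract a b = Fract p q" by (simp add: a_def b_def)
  hence eq: "a * q = p * b" using q b by (simp add: eq_fract)
  have "coprime b a"
    using coprime_quot_of_fract[of "Fract p q"] by (simp add: a_def b_def coprime_commute)
  moreover have "b dvd a * q" by (simp add: eq)
  ultimately have "b dvd q" by (simp add: coprime_dvd_mult_right_iff)
  then obtain d where "q = b * d" by (elim dvdE)
  hence B: "rf_eval_poly b g \<noteq> 0" using assms by (auto simp: rf_eval_poly_mult)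
  have "rf_eval_poly a g * rf_eval_poly q g = rf_eval_poly p g * rf_eval_poly b g"
    by (simp add: eq flip: rf_eval_poly_mult)
  thus ?thesis using assms B
    by (simp add: rf_comp_def a_def [symmetric] b_def [symmetric] divide_simps)
qed

lemma trap_node_inj:
  assumes "r > 0" "k > 0"
  shows "inj_on (trap_node c r k) {1..k}"
proof (rule inj_onI)
  fix i j assume ij: "i \<in> {1..k}" "j \<in> {1..k}" "trap_node c r k i = trap_node c r k j"
  hence "exp (\<i> * complex_of_real (trap_angle k i)) = exp (\<i> * complex_of_real (trap_angle k j))"
    using assms by (simp add: trap_node_def)
  then obtain n :: int where
    "\<i> * complex_of_real (trap_angle k i) = \<i> * complex_of_real (trap_angle k j)
       + complex_of_real (2 * of_int n * pi) * \<i>"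
    by (auto simp: exp_eq)
  hence "\<i> * complex_of_real (trap_angle k i) = \<i> * complex_of_real (trap_angle k j + 2 * of_int n * pi)"
    by (simp add: algebra_simps)
  hence "trap_angle k i = trap_angle k j + 2 * of_int n * pi"
    by (metis mult_left_cancel complex_i_not_zero of_real_eq_iff)
  hence "real i * pi = (real j + of_int n * real k) * pi"
    using assms by (simp add: trap_angle_def field_simps)
  hence "real i = real j + of_int n * real k" by simp
  hence "of_int (int i) = (of_int (int j + n * int k) :: real)" by simp
  hence *: "int i = int j + n * int k" by (simp only: of_int_eq_iff)
  have "n = 0"
  proof (rule ccontr)
    assume "n \<noteq> 0"
    hence "\<bar>n * int k\<bar> \<ge> int k" using assms by (simp add: abs_mult mult_le_cancel_right1)
    thus False using * ij by auto
  qed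
  thus "i = j" using * by simp
qed

text \<open>\<open>trap_R c r k\<close> is not constant, so the denominators obtained by substituting it
  into a rational function do not vanish.\<close>

lemma trap_R_nonconst:
  assumes "r > 0" "k > 0"
  shows "trap_R c r k \<noteq> rf_const a"
proof
  assume eq: "trap_R c r k = rf_const a"
  define l where "l = (\<lambda>i. [:trap_node c r k i, -1:])"
  define P where "P = (\<lambda>A. \<Prod>i\<in>A. l i)"
  have l: "rf_const (trap_node c r k i) - rf_Z = to_fract (l i)" for i
    by (simp add: l_def rf_const_def rf_Z_def flip: to_fract_diff)
  have nz: "to_fract (l i) \<noteq> 0" for i by (simp add: l_def)
  have P: "P {1..k} = l i * P ({1..k} - {i})" if "i \<in> {1..k}" for i
    unfolding P_def by (rule prod.remove) (use that in simp_all)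
  have "to_fract ([:a:] * P {1..k}) = trap_R c r k * to_fract (P {1..k})"
    by (simp only: eq rf_const_def to_fract_mult)
  also have "\<dots> = (\<Sum>i = 1..k. to_fract [:trap_weight r k i:] / to_fract (l i) * to_fract (P {1..k}))"
    by (simp only: trap_R_def l sum_distrib_right) (simp only: rf_const_def)
  also have "\<dots> = (\<Sum>i = 1..k. to_fract ([:trap_weight r k i:] * P ({1..k} - {i})))"
  proof (rule sum.cong)
    fix i assume i: "i \<in> {1..k}"
    show "to_fract [:trap_weight r k i:] / to_fract (l i) * to_fract (P {1..k}) =
          to_fract ([:trap_weight r k i:] * P ({1..k} - {i}))"
      unfolding P[OF i] to_fract_mult using nz[of i] by (simp del: to_fract_mult)
  qed simp
  also have "\<dots> = to_fract (\<Sum>i = 1..k. [:trap_weight r k i:] * P ({1..k} - {i}))"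
    by (rule to_fract_sum [symmetric])
  finally have "[:a:] * P {1..k} = (\<Sum>i = 1..k. [:trap_weight r k i:] * P ({1..k} - {i}))"
    by (simp only: to_fract_eq_iff)
  hence "poly ([:a:] * P {1..k}) (trap_node c r k 1) =
         poly (\<Sum>i = 1..k. [:trap_weight r k i:] * P ({1..k} - {i})) (trap_node c r k 1)"
    by (rule arg_cong)
  also have "poly ([:a:] * P {1..k}) (trap_node c r k 1) = 0"
    using assms by (subst P[of 1]) (simp_all add: l_def)
  also have "poly (\<Sum>i = 1..k. [:trap_weight r k i:] * P ({1..k} - {i})) (trap_node c r k 1) =
     (\<Sum>i = 1..k. if i = 1 then trap_weight r k 1 * poly (P ({1..k} - {1})) (trap_node c r k 1) else 0)"
    unfolding poly_sum
  proof (rule sum.cong)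
    fix i assume "i \<in> {1..k}"
    moreover have "poly (P ({1..k} - {i})) (trap_node c r k 1) = 0" if "i \<noteq> 1"
      using that assms by (auto simp: P_def poly_prod l_def intro!: bexI[of _ 1])
    ultimately show "poly ([:trap_weight r k i:] * P ({1..k} - {i})) (trap_node c r k 1) =
      (if i = 1 then trap_weight r k 1 * poly (P ({1..k} - {1})) (trap_node c r k 1) else 0)"
      by auto
  qed simp
  also have "\<dots> = trap_weight r k 1 * poly (P ({1..k} - {1})) (trap_node c r k 1)"
    using assms by simp
  finally have "trap_weight r k 1 * poly (P ({1..k} - {1})) (trap_node c r k 1) = 0"
    by simp
  moreover have "trap_weight r k 1 \<noteq> 0" using assms by (simp add: trap_weight_def)
  moreover have "poly (P ({1..k} - {1})) (trap_node c r k 1) \<noteq> 0"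
  proof -
    have "trap_node c r k i \<noteq> trap_node c r k 1" if "i \<in> {1..k} - {1}" for i
      using inj_onD[OF trap_node_inj[OF assms, of c], of i 1] that assms by auto
    thus ?thesis unfolding P_def poly_prod by (subst prod_zero_iff) (simp_all add: l_def)
  qed
  ultimately show False by simp
qed

end

theory Submission
  imports Defs
begin

text \<open>Put \<open>w = (z - c) / r\<close>. Expanding \<open>(\<sigma>\<^sup>m - g\<^sup>m) / (\<sigma> - g)\<close> as a geometric sum and using that the
  power sums of the roots of \<open>x\<^sup>m = -1\<close> of exponents \<open>1, \<dots>, m - 1\<close> vanish gives the partial
  fraction expansion \<open>1 / (1 + g\<^sup>m) = (1/m) \<Sum>\<^sub>\<sigma> \<sigma> / (\<sigma> - g)\<close>. Hence \<open>R\<^sub>c\<^sub>,\<^sub>r\<^sub>,\<^sub>k = 1 / (1 + w\<^sup>k)\<close>. Since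
  \<open>M(1 / (1 + g)) = g\<close>, the composition formula reads \<open>w\<^sup>k = (w\<^bsup>k1\<^esup>)\<^bsup>k2\<^esup>\<close>, and the two sums are the
  expansion at \<open>g = w\<^bsup>k1\<^esup>\<close> rewritten in terms of \<open>R = 1 / (1 + g)\<close>.\<close>

lemma to_fract_power: "to_fract (p ^ n) = to_fract p ^ n"
  by (induction n) simp_all

lemma rf_const_1 [simp]: "rf_const 1 = 1"
  by (simp add: rf_const_def flip: one_pCons)

lemma rf_const_minus: "rf_const (- a) = - rf_const a"
  using rf_const_add[of a "- a"] by (simp add: add_eq_0_iff)

lemma rf_const_eq_0_iff [simp]: "rf_const a = 0 \<longleftrightarrow> a = 0"
  by (simp add: rf_const_def)

lemma rf_const_divide: "rf_const (a / b) = rf_const a / rf_const b"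
proof (cases "b = 0")
  case False
  then have "rf_const a = rf_const (a / b) * rf_const b"
    by (simp flip: rf_const_mult)
  then show ?thesis using False by (simp add: field_simps)
qed simp

lemma rf_const_power: "rf_const (a ^ n) = rf_const a ^ n"
  by (induction n) (simp_all add: rf_const_mult)

lemma rf_const_sum: "rf_const (\<Sum>x\<in>A. f x) = (\<Sum>x\<in>A. rf_const (f x))"
  by (induction A rule: infinite_finite_induct) (simp_all add: rf_const_add)

lemma rf_const_of_nat: "rf_const (of_nat n) = of_nat n"
  by (induction n) (simp_all add: rf_const_add)

lemma rf_eval_poly_1 [simp]: "rf_eval_poly 1 g = 1"
  by (simp add: one_pCons rf_eval_poly_pCons)

lemma rf_eval_poly_power: "rf_eval_poly (p ^ n) g = rf_eval_poly p g ^ n"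
  by (induction n) (simp_all add: rf_eval_poly_mult)

text \<open>Multiplication by the primitive root of unity exp(2 \<pi> i / m) permutes the roots of
  x^m = -1 and scales their j-th power sum by the j-th power of that number, which differs from 1
  since 0 < j < m.\<close>

lemma sum_powers_roots_minus_one:
  assumes "0 < j" "j < m"
  shows "(\<Sum>x | x ^ m = (-1 :: complex). x ^ j) = 0"
proof -
  define \<zeta> where "\<zeta> = cis (2 * pi / real m)"
  have \<zeta>: "\<zeta> ^ m = 1" "\<zeta> \<noteq> 0"
    using assms unfolding \<zeta>_def Complex.DeMoivre by simp_all
  have "\<zeta> ^ j \<noteq> 1"
  proof
    assume "\<zeta> ^ j = 1"
    then have "cis (2 * pi * real j / real m) = cis (2 * pi * real 0 / real m)"
      by (simp add: \<zeta>_def Complex.DeMoivre mult_ac)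
    then show False
      using inj_onD[OF bij_betw_imp_inj_on[OF Complex.bij_betw_roots_unity[of m]], of j 0] assms by simp
  qed
  have "bij_betw (\<lambda>x. \<zeta> * x) {x. x ^ m = -1} {x. x ^ m = -1}"
    by (rule bij_betw_byWitness[where f' = "\<lambda>x. x / \<zeta>"])
       (use \<zeta> in \<open>auto simp: power_mult_distrib power_divide\<close>)
  from sum.reindex_bij_betw[OF this, of "\<lambda>x. x ^ j"]
  have "\<zeta> ^ j * (\<Sum>x | x ^ m = -1. x ^ j) = (\<Sum>x | x ^ m = -1. x ^ j)"
    by (simp add: power_mult_distrib sum_distrib_left)
  with \<open>\<zeta> ^ j \<noteq> 1\<close> show ?thesis by simp
qed

text \<open>Stated for an arbitrary g because it is needed twice: at g = w with exponent k for the
  closed form of \<open>trap_R\<close>, and at g = w^k1 with exponent k2 for the two sums.\<close>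

lemma partial_fractions_one_plus_power:
  fixes g :: ratfun
  assumes "m > 0" and nz: "1 + g ^ m \<noteq> 0"
  shows "(\<Sum>x | x ^ m = -1. rf_const x / (rf_const x - g)) = of_nat m / (1 + g ^ m)"
proof -
  let ?S = "{x :: complex. x ^ m = -1}"
  have "rf_const x / (rf_const x - g) * (1 + g ^ m) = - (\<Sum>j<m. rf_const (x ^ (m - j)) * g ^ j)"
    if "x \<in> ?S" for x
  proof -
    let ?x = "rf_const x"
    have x: "?x ^ m = -1"
      using that by (simp add: rf_const_minus flip: rf_const_power)
    \<comment> \<open>If g were the constant x, then 1 + g^m would be 1 + x^m = 0.\<close>
    with nz have "?x - g \<noteq> 0" by auto
    have "1 + g ^ m = g ^ m - ?x ^ m" by (simp add: x)
    also have "\<dots> = (g - ?x) * (\<Sum>j<m. ?x ^ (m - Suc j) * g ^ j)"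
      by (rule power_diff_sumr2)
    finally have "?x / (?x - g) * (1 + g ^ m) = - (?x * (\<Sum>j<m. ?x ^ (m - Suc j) * g ^ j))"
      using \<open>?x - g \<noteq> 0\<close> by (simp add: divide_simps) (simp add: algebra_simps)
    also have "?x * (\<Sum>j<m. ?x ^ (m - Suc j) * g ^ j) = (\<Sum>j<m. rf_const (x ^ (m - j)) * g ^ j)"
      unfolding sum_distrib_left
      by (intro sum.cong refl)
         (simp add: rf_const_power Suc_diff_Suc flip: mult.assoc power_Suc)
    finally show ?thesis .
  qed
  then have "(\<Sum>x\<in>?S. rf_const x / (rf_const x - g)) * (1 + g ^ m)
      = (\<Sum>x\<in>?S. - (\<Sum>j<m. rf_const (x ^ (m - j)) * g ^ j))"
    by (simp add: sum_distrib_right)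
  also have "\<dots> = - (\<Sum>j<m. rf_const (\<Sum>x\<in>?S. x ^ (m - j)) * g ^ j)"
    unfolding sum_negf rf_const_sum sum_distrib_right by (subst sum.swap) simp
  \<comment> \<open>The exponents m - j run through m, ..., 1. Only j = 0 survives: there each of
    the m roots contributes x^m = -1.\<close>
  also have "(\<Sum>j<m. rf_const (\<Sum>x\<in>?S. x ^ (m - j)) * g ^ j)
      = (\<Sum>j<m. if j = 0 then - of_nat m else 0)"
  proof (intro sum.cong refl)
    fix j assume "j \<in> {..<m}"
    moreover have "(\<Sum>x\<in>?S. x ^ m) = - of_nat m"
      using assms by (simp add: card_nth_roots)
    ultimately show "rf_const (\<Sum>x\<in>?S. x ^ (m - j)) * g ^ j = (if j = 0 then - of_nat m else 0)"
      by (cases "j = 0")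
         (simp_all add: sum_powers_roots_minus_one rf_const_minus rf_const_of_nat)
  qed
  also have "\<dots> = - of_nat m" using assms by simp
  finally show ?thesis using nz by (simp add: field_simps)
qed

text \<open>Surjectivity comes from counting: the values are m distinct roots, by
  \<open>trap_node_inj\<close> at centre 0 and radius 1, and the equation has exactly m
  roots.\<close>

lemma trap_angle_bij_betw:
  assumes "m > 0"
  shows "bij_betw (\<lambda>i. exp (\<i> * complex_of_real (trap_angle m i))) {1..m} {x. x ^ m = -1}"
proof -
  let ?e = "\<lambda>i. exp (\<i> * complex_of_real (trap_angle m i))"
  have inj: "inj_on ?e {1..m}"
    using trap_node_inj[of 1 m 0] assms by (simp add: trap_node_def[abs_def])
  have "?e i ^ m = -1" for i
  proof -
    have "?e i ^ m = exp (\<i> * of_real ((2 * real i - 1) * pi))"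
      using assms by (simp add: trap_angle_def flip: exp_of_nat_mult)
    also have "\<dots> = cis (2 * pi * real i - pi)"
      unfolding cis_conv_exp by (simp add: algebra_simps)
    also have "\<dots> = cis (2 * pi * real i) / cis pi"
      by (rule cis_divide [symmetric])
    also have "\<dots> = -1"
      using cis_multiple_2pi[of "real i"] by simp
    finally show ?thesis .
  qed
  then have "?e ` {1..m} \<subseteq> {x. x ^ m = -1}" by auto
  moreover have "card (?e ` {1..m}) = card {x :: complex. x ^ m = -1}"
    unfolding card_image[OF inj] using assms by (simp add: card_nth_roots)
  ultimately have "?e ` {1..m} = {x. x ^ m = -1}"
    using assms by (intro card_subset_eq finite_nth_roots) auto
  with inj show ?thesis by (simp add: bij_betw_def)
qed

text \<open>The coordinate w in which the circle of quadrature becomes the unit circle and its k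
  nodes become the roots of x^k = -1.\<close>

definition rf_scaled :: "complex \<Rightarrow> real \<Rightarrow> ratfun" where
  "rf_scaled c r = (rf_Z - rf_const c) / rf_const (of_real r)"

lemma rf_scaled_conv_to_fract: "rf_scaled c r = to_fract [:- c / of_real r, 1 / of_real r:]"
\<comment> \<open>For r = 0 both sides are 0 by the convention x / 0 = 0.\<close>
proof (cases "r = 0")
  case False
  have "to_fract [:- c / of_real r, 1 / of_real r:] * rf_const (of_real r) = rf_Z - rf_const c"
    using False by (simp add: rf_const_def rf_Z_def flip: to_fract_mult to_fract_diff)
  with False show ?thesis by (simp add: rf_scaled_def field_simps)
qed (simp add: rf_scaled_def)

text \<open>At z = c the coordinate w vanishes, so the polynomial 1 + w^k takes the value 1
  there.\<close>

lemma one_plus_rf_scaled_power_nonzero: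
  assumes "r > 0" "k > 0"
  shows "1 + rf_scaled c r ^ k \<noteq> 0"
proof
  let ?p = "1 + [:- c / of_real r, 1 / of_real r:] ^ k :: complex poly"
  assume "1 + rf_scaled c r ^ k = 0"
  moreover have "to_fract ?p = 1 + rf_scaled c r ^ k"
    by (simp add: rf_scaled_conv_to_fract to_fract_power)
  ultimately have "?p = 0" by (metis to_fract_eq_0_iff)
  then have "poly ?p c = 0" by simp
  with assms show False by (simp add: zero_power)
qed

text \<open>Substituting z = c + r w brings out a factor r in each weight and in each denominator.
  It cancels and leaves the partial fraction expansion at w, divided by k.\<close>

lemma trap_R_closed_form:
  assumes "r > 0" "k > 0"
  shows "trap_R c r k = 1 / (1 + rf_scaled c r ^ k)"
proof -
  let ?w = "rf_scaled c r" and ?e = "\<lambda>i. exp (\<i> * complex_of_real (trap_angle k i))"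
  have r: "rf_const (of_real r) \<noteq> 0" using assms by simp
  have "rf_const (trap_weight r k i) / (rf_const (trap_node c r k i) - rf_Z)
      = rf_const (?e i) / (rf_const (?e i) - ?w) / of_nat k" for i
  proof -
    have "rf_const (trap_node c r k i) - rf_Z = rf_const (of_real r) * (rf_const (?e i) - ?w)"
      using r by (simp add: trap_node_def rf_scaled_def rf_const_add rf_const_mult field_simps)
    then show ?thesis
      using r by (simp add: trap_weight_def rf_const_mult rf_const_divide rf_const_of_nat)
  qed
  then have "trap_R c r k = (\<Sum>i = 1..k. rf_const (?e i) / (rf_const (?e i) - ?w)) / of_nat k"
    by (simp add: trap_R_def sum_divide_distrib)
  also have "(\<Sum>i = 1..k. rf_const (?e i) / (rf_const (?e i) - ?w))
      = (\<Sum>x | x ^ k = -1. rf_const x / (rf_const x - ?w))"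
    by (rule sum.reindex_bij_betw[OF trap_angle_bij_betw[OF assms(2)]])
  also have "\<dots> = of_nat k / (1 + ?w ^ k)"
    by (rule partial_fractions_one_plus_power)
       (use assms one_plus_rf_scaled_power_nonzero in auto)
  finally show ?thesis
    using assms by (simp flip: rf_const_of_nat)
qed

text \<open>For centre 0 and radius 1 the coordinate w is z itself. The hypothesis on g is what
  allows substitution into 1 / (1 + z^m) without reducing that fraction first.\<close>

lemma rf_comp_trap_R_0_1:
  assumes "m > 0" "1 + g ^ m \<noteq> 0"
  shows "rf_comp (trap_R 0 1 m) g = 1 / (1 + g ^ m)"
proof -
  have "trap_R 0 1 m = 1 / (1 + to_fract [:0, 1:] ^ m)"
    using assms by (simp add: trap_R_closed_form rf_scaled_conv_to_fract)
  also have "1 + to_fract [:0, 1:] ^ m = to_fract (1 + [:0, 1:] ^ m :: complex poly)"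
    by (simp add: to_fract_power)
  also have "1 / \<dots> = Fract 1 (1 + [:0, 1:] ^ m)"
    by (simp add: Fract_conv_to_fract)
  finally show ?thesis
    using assms
    by (simp add: rf_comp_Fract rf_eval_poly_add rf_eval_poly_power rf_eval_poly_pCons)
qed

lemma rf_comp_rf_M:
  assumes "g \<noteq> 0"
  shows "rf_comp rf_M g = (1 - g) / g"
proof -
  have "rf_M = Fract [:1, -1:] [:0, 1:]"
    by (simp add: rf_M_def rf_Z_def Fract_conv_to_fract one_pCons
             flip: to_fract_1 to_fract_diff)
  then show ?thesis
    using assms rf_comp_Fract[of "[:0, 1:]" g "[:1, -1:]"]
    by (simp add: rf_eval_poly_pCons rf_const_minus)
qed

text \<open>With R = 1 / (1 + g) one has s - R = (g - x) / ((1 + x) (1 + g)), hence R / (s - R) = (1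
  + x) / (g - x), and the factor 1 + x cancels against the denominator of
  \<open>coef_c\<close>.\<close>

lemma coef_c_shift_s_term:
  fixes g :: ratfun
  assumes "x \<noteq> -1" "g \<noteq> rf_const x" "1 + g \<noteq> 0"
  shows "rf_const (coef_c m x) * inverse (rf_const (shift_s x) - 1 / (1 + g)) * (1 / (1 + g))
    = rf_const x / (rf_const x - g) / of_nat m"
proof -
  let ?x = "rf_const x"
  have x: "1 + ?x \<noteq> 0"
    using assms(1) rf_const_eq_0_iff[of "1 + x"] by (simp add: rf_const_add add_eq_0_iff)
  have "rf_const (shift_s x) - 1 / (1 + g) = (g - ?x) / ((1 + ?x) * (1 + g))"
    using x assms(3) by (simp add: shift_s_def rf_const_divide rf_const_add divide_simps)
  then have "inverse (rf_const (shift_s x) - 1 / (1 + g)) * (1 / (1 + g)) = (1 + ?x) / (g - ?x)"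
    using assms(3) by simp
  moreover have "rf_const (coef_c m x) = - (?x / (1 + ?x)) / of_nat m"
    by (simp add: coef_c_def rf_const_minus rf_const_mult rf_const_divide rf_const_add
        rf_const_of_nat)
  ultimately have "rf_const (coef_c m x) * inverse (rf_const (shift_s x) - 1 / (1 + g)) * (1 / (1 + g))
      = - (?x / (1 + ?x)) / of_nat m * ((1 + ?x) / (g - ?x))"
    by (simp only: mult.assoc)
  also have "\<dots> = - (?x / (g - ?x)) / of_nat m"
    using x by simp
  also have "- (?x / (g - ?x)) = ?x / (?x - g)"
    by (metis minus_diff_eq minus_divide_right)
  finally show ?thesis .
qed

theorem theorem5p1:
  fixes c :: complex and r :: real and k k1 k2 :: nat
  assumes "r > 0" and "k1 > 0" and "k2 > 0" and "k = k1 * k2"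
  shows "trap_R c r k = rf_comp (trap_R 0 1 k2) (rf_comp rf_M (trap_R c r k1)) \<and>
    (\<forall>\<sigma> :: nat \<Rightarrow> complex. bij_betw \<sigma> {1..k2} {x. x ^ k2 = -1} \<longrightarrow>
      (even k2 \<longrightarrow>
        trap_R c r k =
          (\<Sum>i = 1..k2. rf_const (coef_c k2 (\<sigma> i)) *
             inverse (rf_const (shift_s (\<sigma> i)) - trap_R c r k1) * trap_R c r k1)) \<and>
      (odd k2 \<and> \<sigma> k2 = -1 \<longrightarrow>
        trap_R c r k =
          (\<Sum>i = 1..k2 - 1. rf_const (coef_c k2 (\<sigma> i)) *
             inverse (rf_const (shift_s (\<sigma> i)) - trap_R c r k1) * trap_R c r k1)
          + rf_const (1 / of_nat k2) * trap_R c r k1))"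
proof -
  define g where "g = rf_scaled c r ^ k1"
  have g1: "1 + g \<noteq> 0" and g2: "1 + g ^ k2 \<noteq> 0"
    using assms one_plus_rf_scaled_power_nonzero[of r k1 c] one_plus_rf_scaled_power_nonzero[of r k c]
    by (simp_all add: g_def power_mult)
  have R1: "trap_R c r k1 = 1 / (1 + g)"
    using assms by (simp add: trap_R_closed_form g_def)
  have R: "trap_R c r k = 1 / (1 + g ^ k2)"
    using assms by (simp add: trap_R_closed_form g_def power_mult)
  have "rf_comp rf_M (trap_R c r k1) = g"
    using g1 by (simp add: R1 rf_comp_rf_M field_simps)
  then have comp: "trap_R c r k = rf_comp (trap_R 0 1 k2) (rf_comp rf_M (trap_R c r k1))"
    using assms(3) g2 by (simp add: R rf_comp_trap_R_0_1)
  have k2: "(of_nat k2 :: ratfun) \<noteq> 0"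
    using assms by (simp flip: rf_const_of_nat)
  \<comment> \<open>\<open>T\<close> is the summand of the expansion at g, \<open>U\<close> the
    summand of the theorem; they agree at every root except -1.\<close>
  define T where "T = (\<lambda>x. rf_const x / (rf_const x - g) / of_nat k2)"
  define U where
    "U = (\<lambda>x. rf_const (coef_c k2 x) * inverse (rf_const (shift_s x) - trap_R c r k1) * trap_R c r k1)"
  have U: "U x = T x" if "x ^ k2 = -1" "x \<noteq> -1" for x
  proof -
    have "rf_const x ^ k2 = -1"
      using that by (simp add: rf_const_minus flip: rf_const_power)
    with g2 have "g \<noteq> rf_const x" by auto
    then show ?thesis
      unfolding U_def T_def R1 using that g1 by (intro coef_c_shift_s_term)
  qed
  have sums: "(even k2 \<longrightarrow> trap_R c r k = (\<Sum>i = 1..k2. U (\<sigma> i))) \<and>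
      (odd k2 \<and> \<sigma> k2 = -1 \<longrightarrow>
        trap_R c r k = (\<Sum>i = 1..k2 - 1. U (\<sigma> i)) + rf_const (1 / of_nat k2) * trap_R c r k1)"
    if \<sigma>: "bij_betw \<sigma> {1..k2} {x. x ^ k2 = -1}" for \<sigma>
  proof -
    have root: "\<sigma> i ^ k2 = -1" if "i \<in> {1..k2}" for i
      using bij_betwE[OF \<sigma>] that by blast
    have "(\<Sum>i = 1..k2. T (\<sigma> i)) = (\<Sum>x | x ^ k2 = -1. T x)"
      by (rule sum.reindex_bij_betw[OF \<sigma>])
    also have "\<dots> = trap_R c r k"
      using partial_fractions_one_plus_power[OF assms(3) g2] k2
      unfolding T_def R by (simp only: flip: sum_divide_distrib) simp
    finally have T: "trap_R c r k = (\<Sum>i = 1..k2. T (\<sigma> i))" ..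
    show ?thesis
    proof (intro conjI impI)
      \<comment> \<open>For even k2 the number -1 is not a root, so all summands agree.\<close>
      assume "even k2"
      have "U (\<sigma> i) = T (\<sigma> i)" if "i \<in> {1..k2}" for i
        using root[OF that] \<open>even k2\<close> by (intro U) auto
      then show "trap_R c r k = (\<Sum>i = 1..k2. U (\<sigma> i))"
        by (simp add: T)
    next
      assume odd: "odd k2 \<and> \<sigma> k2 = -1"
      have "U (\<sigma> i) = T (\<sigma> i)" if "i \<in> {1..k2 - 1}" for i
      proof (rule U)
        show "\<sigma> i ^ k2 = -1" using that by (intro root) auto
        show "\<sigma> i \<noteq> -1"
          using inj_onD[OF bij_betw_imp_inj_on[OF \<sigma>], of i k2] odd that assms(3) by force
      qed
      then have "(\<Sum>i = 1..k2 - 1. U (\<sigma> i)) = (\<Sum>i = 1..k2 - 1. T (\<sigma> i))" by simp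
      \<comment> \<open>The root -1 is split off because \<open>coef_c\<close> and
        \<open>shift_s\<close> divide by 0 there. Its summand in the expansion is 1 / (k2 (1 + g)),
        which is the extra term.\<close>
      moreover have "rf_const (1 / of_nat k2) * trap_R c r k1 = T (\<sigma> k2)"
      proof -
        have "T (\<sigma> k2) = - 1 / (- (1 + g)) / of_nat k2"
          using odd by (simp add: T_def rf_const_minus)
        also have "\<dots> = 1 / (1 + g) / of_nat k2"
          by (simp only: minus_divide_divide)
        finally show ?thesis
          by (simp add: R1 rf_const_divide rf_const_of_nat mult.commute)
      qed
      moreover have "{1..k2} = insert k2 {1..k2 - 1}" "k2 \<notin> {1..k2 - 1}"
        using assms(3) by auto
      ultimately show "trap_R c r k
          = (\<Sum>i = 1..k2 - 1. U (\<sigma> i)) + rf_const (1 / of_nat k2) * trap_R c r k1"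
        by (simp add: T add.commute)
    qed
  qed
  show ?thesis
    using comp sums unfolding U_def by blast
qed

end
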